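(* In the family of transcendental entire functions described in the context there is a function with infinite order of growth. In particular, if $n_k=(\lfloor R_k\rfloor)^k$ for all $k\ge1$, then the resulting entire function $f$ has order of growth $\rho(f)=+\infty$. Here $\lfloor x\rfloor$ is the largest integer less than or equal to the real number $x$.
   Context: Construction of the family. Fix a real number $\lambda\ge1$ and an integer $N\ge4$. Let $p_\lambda(z)=\lambda(2z^2-1)$ and let $F_0=p_\lambda^N$ be the $N$-th iterate of $p_\lambda$, a polynomial of degree $m=2^N\geq 16$ with leading coefficient $(2\lambda)^{m-1}$. Let $R\ge32$ be a sufficiently large real number (depending on $\lambda,N$), in particular such that $\frac12\le\left|\frac{F_0(z)}{(2\lambda)^{m-1}z^m}\right|\le\frac32$ for all $|z|\ge R$. Put $f_0=F_0$, $R_1=2R$, and recursively for $k\ge1$ choose a positive integer $n_k$ (which may depend on $R_1,\dots,R_k$) and set $$F_k(z)=1-\frac12\left(\frac{z}{R_k}\right)^{n_k},\qquad f_k(z)=f_{k-1}(z)F_k(z),\qquad R_{k+1}=\max_{|z|=2R_k}|f_k(z)|.$$ The standing assumption on the integers is $n_1\ge8$ and $n_{k+1}>n_k$ for all $k\ge1$. The function of the family is the entire function $f(z)=\lim_{k\to\infty}f_k(z)=\prod_{k=0}^\infty F_k(z)$ (the product converges uniformly on compact sets). The order of growth is $\rho(f)=\limsup_{z\to\infty}\frac{\log\log|f(z)|}{\log|z|}$ (equivalently $\limsup_{r\to\infty}\frac{\log\log\max_{|z|=r}|f(z)|}{\log r}$). *)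

theory Defs
  imports "HOL-Complex_Analysis.Complex_Analysis" "HOL-Computational_Algebra.Polynomial"
begin

text \<open>The supremum is a maximum for continuous \<open>f\<close> and \<open>r \<ge> 0\<close>.\<close>
definition max_modulus :: "(complex \<Rightarrow> complex) \<Rightarrow> real \<Rightarrow> real" where
  "max_modulus f r = (SUP z\<in>sphere 0 r. cmod (f z))"

text \<open>
  Formulated with the maximum modulus rather than as a limes superior of
  \<open>ln (ln (cmod (f z)))\<close>: near the zeros of \<open>f\<close> the inner logarithm is negative, where
  \<^term>\<open>ln :: real \<Rightarrow> real\<close> has unintended values.  For nonconstant entire \<open>f\<close>
  the maximum modulus eventually exceeds 1.
\<close>
definition growth_order :: "(complex \<Rightarrow> complex) \<Rightarrow> ereal" where
  "growth_order f = Limsup at_top (\<lambda>r. ereal (ln (ln (max_modulus f r)) / ln r))"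

definition transcendental_entire :: "(complex \<Rightarrow> complex) \<Rightarrow> bool" where
  "transcendental_entire f \<longleftrightarrow> f holomorphic_on UNIV \<and> \<not> (\<exists>p. f = poly p)"

definition quad_map :: "real \<Rightarrow> complex \<Rightarrow> complex" where
  "quad_map lam z = of_real lam * (2 * z ^ 2 - 1)"

definition F_zero :: "real \<Rightarrow> nat \<Rightarrow> complex \<Rightarrow> complex" where
  "F_zero lam N = quad_map lam ^^ N"

definition factor :: "real \<Rightarrow> nat \<Rightarrow> complex \<Rightarrow> complex" where
  "factor r d z = 1 - 1 / 2 * (z / of_real r) ^ d"

definition admissible_base :: "real \<Rightarrow> nat \<Rightarrow> real \<Rightarrow> bool" where
  "admissible_base lam N R \<longleftrightarrow> R \<ge> 32 \<and>
     (\<forall>z. cmod z \<ge> R \<longrightarrow>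
        cmod (F_zero lam N z / (of_real (2 * lam) ^ (2 ^ N - 1) * z ^ (2 ^ N))) \<in> {1/2..3/2})"

text \<open>
  \<open>radius lam N R n k\<close> is \<open>R\<^sub>k\<close> (for \<open>k \<ge> 1\<close>; the value at 0 is never used) and
  \<open>partial_fun lam N R n k\<close> is \<open>f\<^sub>k\<close>.  The radius \<open>R\<^sub>k\<close> depends on \<open>n\<close> only through
  \<open>n 1, \<dots>, n (k - 1)\<close>, so \<open>n k\<close> may be chosen in terms of \<open>R\<^sub>1, \<dots>, R\<^sub>k\<close>.
\<close>
fun radius :: "real \<Rightarrow> nat \<Rightarrow> real \<Rightarrow> (nat \<Rightarrow> nat) \<Rightarrow> nat \<Rightarrow> real"
and partial_fun :: "real \<Rightarrow> nat \<Rightarrow> real \<Rightarrow> (nat \<Rightarrow> nat) \<Rightarrow> nat \<Rightarrow> complex \<Rightarrow> complex"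
where
  "radius lam N R n 0 = R"
| "radius lam N R n (Suc 0) = 2 * R"
| "radius lam N R n (Suc (Suc k)) =
     max_modulus (partial_fun lam N R n (Suc k)) (2 * radius lam N R n (Suc k))"
| "partial_fun lam N R n 0 = F_zero lam N"
| "partial_fun lam N R n (Suc k) =
     (\<lambda>z. partial_fun lam N R n k z * factor (radius lam N R n (Suc k)) (n (Suc k)) z)"

definition admissible_exponents :: "(nat \<Rightarrow> nat) \<Rightarrow> bool" where
  "admissible_exponents n \<longleftrightarrow> n 1 \<ge> 8 \<and> (\<forall>k\<ge>1. n (k + 1) > n k)"

definition family_function ::
  "real \<Rightarrow> nat \<Rightarrow> real \<Rightarrow> (nat \<Rightarrow> nat) \<Rightarrow> (complex \<Rightarrow> complex) \<Rightarrow> bool" where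
  "family_function lam N R n f \<longleftrightarrow> admissible_exponents n \<and>
     (\<forall>K. compact K \<longrightarrow> uniform_limit K (partial_fun lam N R n) f sequentially)"

text \<open>The remaining lemmas show that the parameters of the construction exist.\<close>

lemma F_zero_asymp:
  assumes "lam \<ge> 1"
  shows "((\<lambda>z. F_zero lam N z / (of_real (2 * lam) ^ (2 ^ N - 1) * z ^ (2 ^ N))) \<longlongrightarrow> 1) at_infinity"
proof (induction N)
  case 0
  have "\<forall>\<^sub>F z in at_infinity. F_zero lam 0 z / (of_real (2 * lam) ^ (2 ^ 0 - 1) * z ^ (2 ^ 0)) = 1"
    using eventually_not_equal_at_infinity[of 0]
    by eventually_elim (simp add: F_zero_def)
  then show ?case by (rule tendsto_eventually)
next
  case (Suc N)
  define m :: nat where "m = 2 ^ N"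
  define a where "a = complex_of_real (2 * lam)"
  have m: "m \<ge> 1" and m2: "2 ^ Suc N = 2 * m" by (simp_all add: m_def)
  have a: "a \<noteq> 0" using assms by (simp add: a_def)
  have pow: "a ^ (2 * m - 1) = a * (a ^ (m - 1))\<^sup>2"
  proof -
    have "2 * m - 1 = Suc (2 * (m - 1))" using m by simp
    then show ?thesis by (simp add: power_mult power_mult_distrib power2_eq_square)
  qed
  have pole: "filterlim (\<lambda>z::complex. z ^ (2 * m)) at_infinity at_infinity"
    using m by (intro filterlim_power_at_infinity filterlim_ident) simp
  have "((\<lambda>z. (F_zero lam N z / (a ^ (m - 1) * z ^ m))\<^sup>2
      - of_real lam / a ^ (2 * m - 1) / z ^ (2 * m)) \<longlongrightarrow> 1\<^sup>2 - 0) at_infinity"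
    using Suc.IH by (intro tendsto_intros tendsto_divide_0[OF tendsto_const pole])
      (simp add: m_def a_def)
  moreover have "\<forall>\<^sub>F z in at_infinity. (F_zero lam N z / (a ^ (m - 1) * z ^ m))\<^sup>2
      - of_real lam / a ^ (2 * m - 1) / z ^ (2 * m)
      = F_zero lam (Suc N) z / (a ^ (2 * m - 1) * z ^ (2 * m))"
    using eventually_not_equal_at_infinity[of 0]
  proof eventually_elim
    case (elim z)
    have "F_zero lam (Suc N) z = a * (F_zero lam N z)\<^sup>2 - of_real lam"
      by (simp add: F_zero_def quad_map_def a_def algebra_simps)
    moreover have "z ^ (2 * m) = (z ^ m)\<^sup>2" by (simp add: power_mult power2_eq_square
          flip: power_mult_distrib)
    ultimately show ?case
      using a elim unfolding pow by (simp add: power_divide power_mult_distrib diff_divide_distrib)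
  qed
  ultimately show ?case
    unfolding m2 a_def by (simp add: tendsto_cong)
qed

lemma eventually_admissible_base:
  assumes "lam \<ge> 1"
  shows "\<forall>\<^sub>F R in at_top. admissible_base lam N R"
proof -
  have "((\<lambda>z. cmod (F_zero lam N z / (of_real (2 * lam) ^ (2 ^ N - 1) * z ^ (2 ^ N)))) \<longlongrightarrow> 1)
      at_infinity"
    using tendsto_norm[OF F_zero_asymp[OF assms]] by simp
  then have "\<forall>\<^sub>F z in at_infinity.
      cmod (F_zero lam N z / (of_real (2 * lam) ^ (2 ^ N - 1) * z ^ (2 ^ N))) \<in> {1/2<..<3/2}"
    by (rule topological_tendstoD) auto
  then obtain b where b: "\<And>z. cmod z \<ge> b \<Longrightarrow>
      cmod (F_zero lam N z / (of_real (2 * lam) ^ (2 ^ N - 1) * z ^ (2 ^ N))) \<in> {1/2<..<3/2}"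
    unfolding eventually_at_infinity by blast
  have "admissible_base lam N R" if "R \<ge> max 32 b" for R
    unfolding admissible_base_def using that b by (fastforce intro: less_imp_le)
  then show ?thesis unfolding eventually_at_top_linorder by blast
qed

lemma radius_partial_fun_cong:
  "(\<And>j. j < k \<Longrightarrow> n j = n' j) \<Longrightarrow> radius lam N R n k = radius lam N R n' k"
  "(\<And>j. j \<le> k \<Longrightarrow> n j = n' j) \<Longrightarrow> partial_fun lam N R n k = partial_fun lam N R n' k"
proof (induction lam N R n k and lam N R n k rule: radius_partial_fun.induct)
  case (3 lam N R n k)
  have "partial_fun lam N R n (Suc k) = partial_fun lam N R n' (Suc k)"
    and "radius lam N R n (Suc k) = radius lam N R n' (Suc k)"
    using 3 by (simp_all add: less_Suc_eq_le del: partial_fun.simps)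
  then show ?case by (simp del: partial_fun.simps)
next
  case (5 lam N R n k)
  have "partial_fun lam N R n k = partial_fun lam N R n' k"
    and "radius lam N R n (Suc k) = radius lam N R n' (Suc k)"
    using 5 by simp_all
  then show ?case using 5(3) by simp
qed simp_all

lemma exists_floor_power_exponents:
  "\<exists>n. \<forall>k. n k = nat \<lfloor>radius lam N R n k\<rfloor> ^ k"
proof (rule dependent_wellorder_choice)
  fix r k and n n' :: "nat \<Rightarrow> nat"
  assume "\<And>j. j < k \<Longrightarrow> n j = n' j"
  then show "(r = nat \<lfloor>radius lam N R n k\<rfloor> ^ k) = (r = nat \<lfloor>radius lam N R n' k\<rfloor> ^ k)"
    using radius_partial_fun_cong(1)[of k n n'] by simp
qed simp

end

theory Submission imports Defs "HOL-Real_Asymp.Real_Asymp" begin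

text \<open>
  Write \<open>R\<^sub>k\<close> for the radii, \<open>F\<^sub>k\<close> for the factors, \<open>f\<^sub>k\<close> for the partial products and
  \<open>M(r, f)\<close> for the maximum modulus.  The idea is that on the circle of radius \<open>2 R\<^sub>k\<close> the
  limit \<open>f\<close> is comparable with \<open>f\<^sub>k\<close>, and that on this circle \<open>F\<^sub>k\<close> alone already has
  size about \<open>2^n\<^sub>k\<close>.  Choosing \<open>n\<^sub>k\<close> as the \<open>k\<close>-th power of roughly \<open>R\<^sub>k\<close> therefore
  forces \<open>ln M(2 R\<^sub>k, f)\<close> to exceed any fixed power of \<open>R\<^sub>k\<close>.

  In detail, let \<open>|z| = 2 R\<^sub>k\<close>.  A factor \<open>F\<^sub>j\<close> with \<open>1 \<le> j < k\<close> has \<open>|F\<^sub>j z| \<ge> 1\<close>,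
  because \<open>|z| \<ge> 2 R\<^sub>j\<close> and \<open>n\<^sub>j \<ge> 2\<close>; also \<open>|F\<^sub>0 z| \<ge> |z|\<close>, and \<open>|F\<^sub>k z| \<ge> 2^(n\<^sub>k - 2)\<close>.  Hence
  \<open>R\<^sub>k\<^sub>+\<^sub>1 = M(2 R\<^sub>k, f\<^sub>k) \<ge> 2^(n\<^sub>k - 1) R\<^sub>k\<close> (lemma \<open>radius_Suc_ge\<close>), so that for
  \<open>n\<^sub>k \<ge> 3\<close> the radii grow at least like powers of 4.  The factors \<open>F\<^sub>j\<close> with \<open>j > k\<close> are then so
  close to 1 that their product is at least \<open>1/2\<close> in modulus, which gives
  \<open>M(2 R\<^sub>k, f) \<ge> R\<^sub>k\<^sub>+\<^sub>1 / 2 \<ge> 2^n\<^sub>k\<close> (lemma \<open>max_modulus_limit_ge\<close>).  The same decay of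
  \<open>F\<^sub>j - 1\<close> makes the product converge uniformly on compact sets.

  With \<open>n\<^sub>k = \<lfloor>R\<^sub>k\<rfloor>^k\<close> one gets \<open>ln M(r, f) \<ge> (sqrt r)^k\<close> at \<open>r = 2 R\<^sub>k\<close>, and hence
  \<open>ln (ln M(r, f)) / ln r \<ge> k/2\<close>.  This is unbounded, so the order is infinite; the
  same bound rules out polynomials.
\<close>

section \<open>Maximum modulus and order of growth\<close>

lemma norm_le_max_modulus:
  assumes "continuous_on (sphere 0 r) f" and "cmod z = r"
  shows "cmod (f z) \<le> max_modulus f r"
proof -
  have "compact ((\<lambda>z. cmod (f z)) ` sphere 0 r)"
    using assms(1) by (intro compact_continuous_image continuous_intros) auto
  then have "bdd_above ((\<lambda>z. cmod (f z)) ` sphere 0 r)"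
    by (intro bounded_imp_bdd_above compact_imp_bounded)
  then show ?thesis
    unfolding max_modulus_def using assms(2) by (intro cSUP_upper) auto
qed

lemma max_modulus_le:
  assumes "r \<ge> 0" and "\<And>z. cmod z = r \<Longrightarrow> cmod (f z) \<le> B"
  shows "max_modulus f r \<le> B"
proof -
  have "complex_of_real r \<in> sphere 0 r"
    using assms(1) by simp
  then have "sphere (0::complex) r \<noteq> {}"
    by blast
  then show ?thesis
    unfolding max_modulus_def using assms(2) by (intro cSUP_least) auto
qed

lemma max_modulus_poly_le:
  assumes "r \<ge> 1"
  shows "max_modulus (poly p) r \<le> (\<Sum>i\<le>degree p. cmod (coeff p i)) * r ^ degree p"
proof (rule max_modulus_le)
  fix z assume z: "cmod z = r"
  have "cmod (poly p z) \<le> (\<Sum>i\<le>degree p. cmod (coeff p i * z ^ i))"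
    unfolding poly_altdef by (rule norm_sum)
  also have "\<dots> \<le> (\<Sum>i\<le>degree p. cmod (coeff p i) * r ^ degree p)"
    using assms z by (intro sum_mono) (auto simp: norm_mult norm_power
        intro!: mult_left_mono power_increasing)
  finally show "cmod (poly p z) \<le> (\<Sum>i\<le>degree p. cmod (coeff p i)) * r ^ degree p"
    by (simp add: sum_distrib_right)
qed (use assms in simp)

text \<open>
  At \<open>r k\<close> the quotient that defines the order is at least \<open>k / 2\<close>.  The square root leaves
  room for the constants lost in comparing \<open>\<lfloor>x\<rfloor>\<close> with \<open>2 x\<close> later on.
\<close>

lemma growth_order_eq_infinity:
  assumes r: "filterlim r at_top sequentially"
    and large: "\<forall>\<^sub>F k in sequentially. max_modulus f (r k) \<ge> exp (sqrt (r k) ^ k)"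
  shows "growth_order f = \<infinity>"
proof -
  have "ereal C \<le> growth_order f" for C
    unfolding growth_order_def Limsup_def
  proof (rule INF_greatest)
    fix P :: "real \<Rightarrow> bool" assume "P \<in> {P. eventually P at_top}"
    then have "\<forall>\<^sub>F k in sequentially. P (r k)"
      using r by (simp add: filterlim_iff)
    moreover have "\<forall>\<^sub>F k in sequentially. r k > 1"
      using r by (simp add: filterlim_at_top_dense)
    moreover have "\<forall>\<^sub>F k in sequentially. C \<le> real k / 2"
      by real_asymp
    ultimately have "\<forall>\<^sub>F k in sequentially. P (r k) \<and> r k > 1 \<and> C \<le> real k / 2 \<and>
        max_modulus f (r k) \<ge> exp (sqrt (r k) ^ k)"
      using large by eventually_elim simp
    then obtain k where k: "P (r k)" "r k > 1" "C \<le> real k / 2"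
        "max_modulus f (r k) \<ge> exp (sqrt (r k) ^ k)"
      using eventually_happens'[OF sequentially_bot] by blast
    have "0 < sqrt (r k) ^ k" using k by simp
    have "sqrt (r k) ^ k \<le> ln (max_modulus f (r k))"
      using k(4) by (subst ln_ge_iff) (auto intro: less_le_trans[OF exp_gt_zero])
    then have "ln (sqrt (r k) ^ k) \<le> ln (ln (max_modulus f (r k)))"
      using \<open>0 < sqrt (r k) ^ k\<close> by (subst ln_le_cancel_iff) auto
    moreover have "ln (sqrt (r k) ^ k) = real k / 2 * ln (r k)"
      using k by (simp add: ln_realpow ln_sqrt)
    moreover have "C * ln (r k) \<le> real k / 2 * ln (r k)"
      using k by (intro mult_right_mono) auto
    ultimately have "C * ln (r k) \<le> ln (ln (max_modulus f (r k)))" by linarith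
    then have "C \<le> ln (ln (max_modulus f (r k))) / ln (r k)"
      using k by (simp add: pos_le_divide_eq)
    then have "ereal C \<le> ereal (ln (ln (max_modulus f (r k))) / ln (r k))"
      by simp
    also have "\<dots> \<le> (SUP r\<in>Collect P. ereal (ln (ln (max_modulus f r)) / ln r))"
      using k(1) by (intro SUP_upper) simp
    finally show "ereal C \<le> (SUP r\<in>Collect P. ereal (ln (ln (max_modulus f r)) / ln r))" .
  qed
  then show ?thesis
    by (rule ereal_top)
qed

text \<open>
  A polynomial is dominated by a fixed power of the radius, hence by the exponential of the
  square root of the radius.
\<close>

lemma not_poly_if_max_modulus_large:
  assumes r: "filterlim r at_top sequentially"
    and large: "\<forall>\<^sub>F k in sequentially. max_modulus f (r k) \<ge> exp (sqrt (r k) ^ k)"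
  shows "f \<noteq> poly p"
proof
  assume f: "f = poly p"
  define C where "C = (\<Sum>i\<le>degree p. cmod (coeff p i)) + 1"
  define d where "d = degree p"
  have "C > 0" unfolding C_def by (intro add_nonneg_pos sum_nonneg) auto
  then have "\<forall>\<^sub>F x in at_top. C * x powr d < exp (sqrt x)"
    by real_asymp
  then have "\<forall>\<^sub>F k in sequentially. C * r k powr d < exp (sqrt (r k))"
    using r by (rule eventually_compose_filterlim)
  moreover have "\<forall>\<^sub>F k in sequentially. r k > 1"
    using r by (simp add: filterlim_at_top_dense)
  ultimately have "\<forall>\<^sub>F k in sequentially. False"
    using large eventually_ge_at_top[of 1]
  proof eventually_elim
    case (elim k)
    have "exp (sqrt (r k)) \<le> exp (sqrt (r k) ^ k)"
      using elim power_increasing[of 1 k "sqrt (r k)"] by simp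
    also have "\<dots> \<le> max_modulus (poly p) (r k)"
      using elim f by simp
    also have "\<dots> \<le> (\<Sum>i\<le>degree p. cmod (coeff p i)) * r k ^ degree p"
      using elim by (intro max_modulus_poly_le) simp
    also have "\<dots> \<le> C * r k ^ d"
      unfolding C_def d_def using elim by (intro mult_right_mono) auto
    also have "\<dots> = C * r k powr d"
      using elim by (simp add: powr_realpow)
    finally show False using elim by simp
  qed
  then show False by simp
qed

section \<open>The factors outside and inside the critical radii\<close>

text \<open>
  The quotient bound gives \<open>|F_zero z| \<ge> (2 lam)^(m - 1) |z|^m / 2\<close> with \<open>m = 2 ^ N \<ge> 2\<close>, so one
  factor \<open>2 lam\<close> pays for the denominator 2.
\<close>

lemma norm_F_zero_ge:
  assumes "lam \<ge> 1" "N \<ge> 1" "admissible_base lam N R" "cmod z \<ge> R"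
  shows "cmod (F_zero lam N z) \<ge> cmod z"
proof -
  have z: "cmod z \<ge> 1" and pos: "cmod z > 0" and
    quot: "1 / 2 \<le> cmod (F_zero lam N z / (of_real (2 * lam) ^ (2 ^ N - 1) * z ^ (2 ^ N)))"
    using assms(3,4) by (fastforce simp: admissible_base_def)+
  have "(2::nat) ^ N \<ge> 2 ^ 1"
    using assms(2) by (intro power_increasing) auto
  then have m: "(2::nat) ^ N \<ge> 2" by simp
  have "2 * 1 \<le> (2 * lam) ^ 1" using assms(1) by simp
  also have "\<dots> \<le> (2 * lam) ^ (2 ^ N - 1)"
    using assms(1) m by (intro power_increasing) auto
  finally have "2 * cmod z ^ 1 \<le> (2 * lam) ^ (2 ^ N - 1) * cmod z ^ (2 ^ N)"
    using assms(1) m z by (intro mult_mono power_increasing) auto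
  also have "\<dots> \<le> 2 * cmod (F_zero lam N z)"
  proof -
    have "0 < (2 * lam) ^ (2 ^ N - 1) * cmod z ^ (2 ^ N)"
      using assms(1) pos by simp
    moreover have "cmod (F_zero lam N z / (of_real (2 * lam) ^ (2 ^ N - 1) * z ^ (2 ^ N)))
        = cmod (F_zero lam N z) / ((2 * lam) ^ (2 ^ N - 1) * cmod z ^ (2 ^ N))"
      using assms(1) by (simp add: norm_divide norm_mult norm_power)
    ultimately show ?thesis
      using quot by (simp add: pos_le_divide_eq)
  qed
  finally show ?thesis by simp
qed

text \<open>
  The power term has modulus at least \<open>2 ^ d / 2\<close>, and subtracting the constant 1 costs at
  most half of that.
\<close>

lemma norm_factor_ge:
  assumes "r > 0" "d \<ge> 2" "cmod z \<ge> 2 * r"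
  shows "cmod (factor r d z) \<ge> 2 ^ (d - 2)"
proof -
  have "2 \<le> cmod z / r" using assms by (simp add: pos_le_divide_eq)
  then have "2 ^ d \<le> (cmod z / r) ^ d" by (intro power_mono) auto
  also have "\<dots> = cmod ((z / of_real r) ^ d)"
    using assms by (simp add: norm_power norm_divide)
  finally have "2 ^ d / 2 - 1 \<le> cmod (1 / 2 * (z / of_real r) ^ d) - cmod 1"
    by (simp add: norm_mult)
  also have "\<dots> \<le> cmod (factor r d z)"
    unfolding factor_def by (metis norm_minus_commute norm_triangle_ineq2)
  finally have "2 ^ d / 2 - 1 \<le> cmod (factor r d z)" .
  moreover obtain e where "d = e + 2"
    using assms(2) by (metis add.commute le_Suc_ex)
  moreover have "(2::real) ^ e \<ge> 1" by simp
  ultimately show ?thesis by (simp del: one_le_power two_realpow_ge_one)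
qed

lemma norm_factor_minus_1_le:
  assumes "r > 0" "d \<ge> 1" "cmod z \<le> q * r" "q \<le> 1"
  shows "cmod (factor r d z - 1) \<le> q / 2"
proof -
  have q: "cmod z / r \<le> q" using assms by (simp add: pos_divide_le_eq)
  then have q1: "cmod z / r \<le> 1" using assms(4) by (rule order_trans)
  have "cmod (factor r d z - 1) = (cmod z / r) ^ d / 2"
    using assms by (simp add: factor_def norm_mult norm_power norm_divide)
  also have "(cmod z / r) ^ d \<le> (cmod z / r) ^ 1"
    using assms(1,2) q1 by (intro power_decreasing) auto
  finally show ?thesis using q by simp
qed

lemma continuous_on_factor [continuous_intros]: "continuous_on A (factor r d)"
  unfolding factor_def by (cases "r = 0") (auto intro!: continuous_intros)

lemma holomorphic_F_zero: "F_zero lam N holomorphic_on A"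
proof (induction N)
  case 0
  then show ?case by (simp add: F_zero_def)
next
  case (Suc N)
  have "F_zero lam (Suc N) = (\<lambda>z. of_real lam * (2 * F_zero lam N z ^ 2 - 1))"
    by (simp add: F_zero_def quad_map_def fun_eq_iff)
  then show ?case using Suc by (auto intro!: holomorphic_intros)
qed

lemma holomorphic_partial_fun: "partial_fun lam N R n k holomorphic_on A"
proof (induction k)
  case (Suc k)
  then show ?case
    unfolding partial_fun.simps factor_def
    by (cases "radius lam N R n (Suc k) = 0") (auto intro!: holomorphic_intros)
qed (simp add: holomorphic_F_zero)

section \<open>Growth of the radii\<close>

text \<open>
  Far outside its critical radius a factor has modulus at least 1, so all that remains is the
  contribution of \<^const>\<open>F_zero\<close>.
\<close>

lemma norm_partial_fun_ge:
  assumes "lam \<ge> 1" "N \<ge> 1" "admissible_base lam N R" "cmod z \<ge> R"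
    and "\<And>j. 1 \<le> j \<Longrightarrow> j \<le> k \<Longrightarrow>
      n j \<ge> 2 \<and> radius lam N R n j > 0 \<and> 2 * radius lam N R n j \<le> cmod z"
  shows "cmod (partial_fun lam N R n k z) \<ge> cmod z"
  using assms(5)
proof (induction k)
  case 0
  then show ?case using norm_F_zero_ge assms(1-4) by simp
next
  case (Suc k)
  have "(1::real) \<le> 2 ^ (n (Suc k) - 2)" by simp
  also have "\<dots> \<le> cmod (factor (radius lam N R n (Suc k)) (n (Suc k)) z)"
    using Suc.prems[of "Suc k"] by (intro norm_factor_ge) auto
  finally have "cmod z * 1 \<le> cmod (partial_fun lam N R n k z) *
      cmod (factor (radius lam N R n (Suc k)) (n (Suc k)) z)"
    using Suc by (intro mult_mono) auto
  then show ?case by (simp add: norm_mult)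
qed

text \<open>
  The maximum of \<open>f\<^sub>k\<close> on the circle of radius \<open>2 R\<^sub>k\<close> is at least its modulus at the positive
  real point \<open>z\<close> of that circle.  There \<open>f\<^bsub>k-1\<^esub>\<close> contributes \<open>|z| = 2 R\<^sub>k\<close> and the last factor
  contributes \<open>2^(n\<^sub>k - 2)\<close>.  Monotonicity of the earlier radii is a hypothesis because it is
  itself derived from this estimate by induction.
\<close>

lemma radius_Suc_ge:
  assumes base: "lam \<ge> 1" "N \<ge> 1" "admissible_base lam N R" and "k \<ge> 1"
    and n: "\<And>j. 1 \<le> j \<Longrightarrow> j \<le> k \<Longrightarrow> n j \<ge> 2"
    and mono: "\<And>j. 1 \<le> j \<Longrightarrow> j \<le> k \<Longrightarrow> R \<le> radius lam N R n j \<and>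
      radius lam N R n j \<le> radius lam N R n k"
  shows "radius lam N R n (Suc k) \<ge> 2 ^ (n k - 1) * radius lam N R n k"
proof -
  let ?R = "radius lam N R n"
  obtain i where k: "k = Suc i" using \<open>k \<ge> 1\<close> by (cases k) auto
  have R: "0 < ?R k" "R \<le> ?R k"
    using base(3) mono[OF \<open>k \<ge> 1\<close>] by (simp_all add: admissible_base_def)
  define z where "z = complex_of_real (2 * ?R k)"
  have z: "cmod z = 2 * ?R k" unfolding z_def norm_of_real using R by simp
  have pf: "cmod (partial_fun lam N R n i z) \<ge> cmod z"
  proof (rule norm_partial_fun_ge[OF base])
    show "R \<le> cmod z" using z R by simp
    show "n j \<ge> 2 \<and> 0 < ?R j \<and> 2 * ?R j \<le> cmod z" if "1 \<le> j" "j \<le> i" for j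
      using mono[of j] n[of j] that z k base(3) by (auto simp: admissible_base_def)
  qed
  have nk: "n k \<ge> 2" using n[of k] \<open>k \<ge> 1\<close> by simp
  then have "n k - 1 = Suc (n k - 2)" by simp
  then have "2 ^ (n k - 1) * ?R k = cmod z * 2 ^ (n k - 2)"
    by (simp add: z)
  also have "\<dots> \<le> cmod (partial_fun lam N R n i z) * cmod (factor (?R k) (n k) z)"
    using pf nk R z by (intro mult_mono norm_factor_ge) auto
  also have "\<dots> = cmod (partial_fun lam N R n k z)"
    by (simp add: norm_mult k)
  also have "\<dots> \<le> ?R (Suc k)"
    unfolding k radius.simps
    by (intro norm_le_max_modulus holomorphic_on_imp_continuous_on holomorphic_partial_fun
        z[unfolded k])
  finally show ?thesis .
qed

text \<open>
  The exponents are constrained below \<open>k\<close> only: when \<open>n k\<close> is itself defined from the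
  \<open>k\<close>-th radius, this bound on the radius is what shows that \<open>n k\<close> is large.
\<close>

lemma radius_ge:
  assumes base: "lam \<ge> 1" "N \<ge> 1" "admissible_base lam N R" and "k \<ge> 1"
    and n: "\<And>j. 1 \<le> j \<Longrightarrow> j < k \<Longrightarrow> n j \<ge> 2"
  shows "radius lam N R n k \<ge> 64 \<and> (\<forall>j. 1 \<le> j \<longrightarrow> j \<le> k \<longrightarrow>
    R \<le> radius lam N R n j \<and> radius lam N R n j \<le> radius lam N R n k)"
  using assms(4,5)
proof (induction k rule: dec_induct)
  let ?R = "radius lam N R n"
  case base
  have "R \<ge> 32" using assms(3) by (simp add: admissible_base_def)
  moreover have "j = Suc 0" if "1 \<le> j" "j \<le> 1" for j :: nat using that by simp
  ultimately show ?case by fastforce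
next
  let ?R = "radius lam N R n"
  case (step k)
  have IH: "64 \<le> ?R k" "\<And>j. 1 \<le> j \<Longrightarrow> j \<le> k \<Longrightarrow> R \<le> ?R j \<and> ?R j \<le> ?R k"
    using step.IH step.prems by auto
  have "1 * ?R k \<le> 2 ^ (n k - 1) * ?R k"
    using IH(1) by (intro mult_right_mono) auto
  also have "\<dots> \<le> ?R (Suc k)"
    using step IH by (intro radius_Suc_ge[OF assms(1-3)]) auto
  finally have le: "?R k \<le> ?R (Suc k)" by simp
  have "R \<le> ?R j \<and> ?R j \<le> ?R (Suc k)" if "1 \<le> j" "j \<le> Suc k" for j
    using IH(2)[of j] IH(2)[of k] le that step.hyps by (cases "j = Suc k") auto
  then show ?case using IH(1) le by auto
qed

lemma radius_Suc_ge_pow: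
  assumes "lam \<ge> 1" "N \<ge> 1" "admissible_base lam N R"
    and "\<And>j. j \<ge> 1 \<Longrightarrow> n j \<ge> 2" and "k \<ge> 1"
  shows "radius lam N R n (Suc k) \<ge> 2 ^ (n k - 1) * radius lam N R n k"
  using assms radius_ge[OF assms(1-3,5)] by (intro radius_Suc_ge) auto

text \<open>
  Exponents of at least 3 make each radius at least four times its predecessor.  A ratio of 4
  rather than 2 compensates for the circle having radius \<open>2 R\<^sub>k\<close>: already \<open>R\<^sub>k\<^sub>+\<^sub>1\<close> is at least
  twice as large as the radius of that circle.
\<close>

lemma radius_add_ge:
  assumes base: "lam \<ge> 1" "N \<ge> 1" "admissible_base lam N R"
    and n: "\<And>j. j \<ge> 1 \<Longrightarrow> n j \<ge> 3" and k: "k \<ge> 1"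
  shows "radius lam N R n (k + i) \<ge> 4 ^ i * radius lam N R n k"
proof (induction i)
  case (Suc i)
  have n2: "n j \<ge> 2" if "j \<ge> 1" for j using n[OF that] by simp
  have pos: "radius lam N R n (k + i) \<ge> 64"
    using radius_ge[OF base, of "k + i" n] k n2 by auto
  have "(2::real) ^ 2 \<le> 2 ^ (n (k + i) - 1)"
    using n[of "k + i"] k by (intro power_increasing) auto
  then have "4 * radius lam N R n (k + i) \<le> 2 ^ (n (k + i) - 1) * radius lam N R n (k + i)"
    using pos by (intro mult_right_mono) auto
  also have "\<dots> \<le> radius lam N R n (k + Suc i)"
    using radius_Suc_ge_pow[OF base n2, where k = "k + i"] k by simp
  finally show ?case using Suc by simp
qed simp

section \<open>Convergence of the product\<close>

text \<open>
  On a disc of radius \<open>B\<close> the deviation of the \<open>j\<close>-th factor from 1 is at most \<open>B / 4 ^ j\<close> once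
  \<open>4 ^ j\<close> exceeds \<open>B\<close>, so the Weierstrass test applies to the product.  The polynomial
  \<^const>\<open>F_zero\<close> is treated as the factor with index 0.
\<close>

lemma uniformly_convergent_partial_fun:
  assumes base: "lam \<ge> 1" "N \<ge> 1" "admissible_base lam N R"
    and n: "\<And>j. j \<ge> 1 \<Longrightarrow> n j \<ge> 3" and K: "compact K"
  shows "uniformly_convergent_on K (partial_fun lam N R n)"
proof -
  define P where "P j = (case j of 0 \<Rightarrow> F_zero lam N
    | Suc i \<Rightarrow> factor (radius lam N R n (Suc i)) (n (Suc i)))" for j
  obtain B where B: "\<And>z. z \<in> K \<Longrightarrow> cmod z \<le> B" "B > 0"
    using compact_imp_bounded[OF K] by (auto simp: bounded_pos)
  have "uniformly_convergent_on K (\<lambda>m z. \<Prod>j<m. P j z)"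
  proof (rule uniformly_convergent_on_prod'[OF _ K])
    show "continuous_on K (P j)" for j
      by (auto simp: P_def split: nat.split intro!: continuous_on_factor
          holomorphic_on_imp_continuous_on holomorphic_F_zero)
    show "uniformly_convergent_on K (\<lambda>m z. \<Sum>j<m. cmod (P j z - 1))"
    proof (rule Weierstrass_m_test'_ev)
      show "summable (\<lambda>j. B * (1/4) ^ j)"
        by (intro summable_mult summable_geometric) simp
      have "\<forall>\<^sub>F j in sequentially. B * (1/4) ^ j \<le> 1"
        by real_asymp
      then show "\<forall>\<^sub>F j in sequentially. \<forall>z\<in>K. norm (cmod (P j z - 1)) \<le> B * (1/4) ^ j"
        using eventually_ge_at_top[of 1]
      proof eventually_elim
        case (elim j)
        then obtain i where j: "j = Suc i" by (cases j) auto
        have "4 ^ i * 64 \<le> 4 ^ i * radius lam N R n 1"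
          using radius_ge[OF base, of 1 n] by auto
        also have "\<dots> \<le> radius lam N R n (1 + i)"
          by (rule radius_add_ge[OF base n]) auto
        also have "(4::real) ^ j \<le> 4 ^ i * 64" by (simp add: j)
        finally have r: "4 ^ j \<le> radius lam N R n j" by (simp add: j)
        show ?case
        proof
          fix z assume "z \<in> K"
          then have "cmod z \<le> B * (1/4) ^ j * 4 ^ j"
            using B(1) by (simp add: power_one_over)
          also have "\<dots> \<le> B * (1/4) ^ j * radius lam N R n j"
            using r B(2) by (intro mult_left_mono) auto
          finally have "cmod (factor (radius lam N R n j) (n j) z - 1) \<le> B * (1/4) ^ j / 2"
            using elim n[of j] r by (intro norm_factor_minus_1_le) (auto intro: less_le_trans[of _ "4 ^ j"])
          also have "\<dots> \<le> B * (1/4) ^ j"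
            using B(2) by simp
          finally show "norm (cmod (P j z - 1)) \<le> B * (1/4) ^ j"
            by (simp add: P_def j)
        qed
      qed
    qed
  qed
  then obtain g where "uniform_limit K (\<lambda>m z. \<Prod>j<m. P j z) g sequentially"
    by (auto simp: uniformly_convergent_on_def)
  then have "uniform_limit K (\<lambda>k z. \<Prod>j<Suc k. P j z) g sequentially"
    by (rule filterlim_compose[OF _ filterlim_Suc])
  moreover have "(\<lambda>z. \<Prod>j<Suc k. P j z) = partial_fun lam N R n k" for k
  proof (induction k)
    case 0
    then show ?case by (simp add: P_def)
  next
    case (Suc k)
    have "(\<Prod>j<Suc k. P j z) = partial_fun lam N R n k z" for z
      using Suc by (rule fun_cong)
    then show ?case
      by (subst prod.lessThan_Suc) (auto simp: P_def fun_eq_iff simp del: prod.lessThan_Suc)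
  qed
  ultimately show ?thesis
    by (auto simp: uniformly_convergent_on_def)
qed

lemma holomorphic_if_locally_uniform_limit:
  assumes "\<And>k. g k holomorphic_on UNIV"
    and "\<And>K. compact K \<Longrightarrow> uniform_limit K g f sequentially"
  shows "f holomorphic_on UNIV"
proof (rule holomorphic_uniform_sequence)
  show "\<exists>d>0. cball x d \<subseteq> UNIV \<and> uniform_limit (cball x d) g f sequentially" for x
    using assms(2)[of "cball x 1"] by (intro exI[of _ 1]) auto
qed (use assms in auto)

section \<open>Growth of the limit\<close>

text \<open>
  The factor with index \<open>k + i + 1\<close> deviates from 1 by at most \<open>a / 4\<close> with \<open>a = (1/2) ^ i\<close>.
  The constants \<open>1/2 + a / 2\<close> start at 1, stay above \<open>1/2\<close> and absorb each such factor, since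
  \<open>(1/2 + a / 2) (1 - a / 4) \<ge> 1/2 + a / 4\<close> for \<open>0 \<le> a \<le> 1\<close>.
\<close>

lemma norm_partial_fun_add_ge:
  assumes base: "lam \<ge> 1" "N \<ge> 1" "admissible_base lam N R"
    and n: "\<And>j. j \<ge> 1 \<Longrightarrow> n j \<ge> 3" and k: "k \<ge> 1" and z: "cmod z = 2 * radius lam N R n k"
  shows "cmod (partial_fun lam N R n (k + i) z) \<ge>
    (1/2 + (1/2) ^ i / 2) * cmod (partial_fun lam N R n k z)"
proof (induction i)
  case (Suc i)
  let ?R = "radius lam N R n" and ?f = "partial_fun lam N R n"
  define a :: real where "a = (1/2) ^ i"
  have a: "0 < a" "a \<le> 1" by (simp_all add: a_def power_le_one)
  have n2: "n j \<ge> 2" if "j \<ge> 1" for j using n[OF that] by simp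
  have Rk: "?R k \<ge> 64"
    using radius_ge[OF base k, of n] n2 by auto
  define F where "F = factor (?R (k + Suc i)) (n (k + Suc i)) z"
  have "cmod (F - 1) \<le> (a / 2) / 2"
    unfolding F_def
  proof (rule norm_factor_minus_1_le)
    have "4 ^ Suc i * ?R k \<le> ?R (k + Suc i)"
      by (rule radius_add_ge[OF base n k])
    moreover have "(1::real) * 64 \<le> 4 ^ Suc i * ?R k"
      using Rk by (intro mult_mono one_le_power) auto
    ultimately show "0 < ?R (k + Suc i)" by linarith
    have "2 * ?R k * 1 \<le> 2 * ?R k * 2 ^ i"
      using Rk by (intro mult_left_mono one_le_power) auto
    also have "2 * ?R k * 2 ^ i = a / 2 * (4 ^ Suc i * ?R k)"
    proof -
      have "(4::real) ^ i = 2 ^ i * 2 ^ i" by (simp flip: power_mult_distrib)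
      then show ?thesis by (simp add: a_def power_one_over)
    qed
    also have "\<dots> \<le> a / 2 * ?R (k + Suc i)"
      using a by (intro mult_left_mono radius_add_ge[OF base n k]) auto
    finally show "cmod z \<le> a / 2 * ?R (k + Suc i)" using z by simp
  qed (use a n[of "k + Suc i"] in auto)
  then have F: "cmod F \<ge> 1 - a / 4"
    using norm_triangle_ineq2[of 1 F] by (simp add: norm_minus_commute)
  have "a * a \<le> a * 1" using a by (intro mult_left_mono) auto
  then have "1/2 + a / 4 \<le> (1/2 + a / 2) * (1 - a / 4)"
    using a by (simp add: algebra_simps)
  then have "(1/2 + (1/2) ^ Suc i / 2) * cmod (?f k z) \<le>
      (1/2 + a / 2) * (1 - a / 4) * cmod (?f k z)"
    by (intro mult_right_mono) (simp_all add: a_def)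
  also have "\<dots> = (1/2 + a / 2) * cmod (?f k z) * (1 - a / 4)" by simp
  also have "\<dots> \<le> cmod (?f (k + i) z) * cmod F"
    using Suc F a by (intro mult_mono) (auto simp: a_def)
  also have "\<dots> = cmod (?f (k + Suc i) z)"
    by (simp add: F_def norm_mult)
  finally show ?case .
qed simp

text \<open>
  Passing to the limit costs a factor 2 against the maximum of \<open>f\<^sub>k\<close>, which is \<open>R\<^sub>k\<^sub>+\<^sub>1\<close> by
  definition; the factor \<open>R\<^sub>k \<ge> 64\<close> in the lower bound for \<open>R\<^sub>k\<^sub>+\<^sub>1\<close> makes up for it.
\<close>

lemma max_modulus_limit_ge:
  assumes base: "lam \<ge> 1" "N \<ge> 1" "admissible_base lam N R"
    and n: "\<And>j. j \<ge> 1 \<Longrightarrow> n j \<ge> 3" and k: "k \<ge> 1"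
    and lim: "\<And>z. (\<lambda>j. partial_fun lam N R n j z) \<longlonglongrightarrow> f z"
    and cont: "continuous_on UNIV f"
  shows "max_modulus f (2 * radius lam N R n k) \<ge> 2 ^ n k"
proof -
  let ?R = "radius lam N R n" and ?f = "partial_fun lam N R n"
  have n2: "n j \<ge> 2" if "j \<ge> 1" for j using n[OF that] by simp
  have Rk: "?R k \<ge> 64"
    using radius_ge[OF base k, of n] n2 by auto
  have "cmod (?f k z) \<le> 2 * max_modulus f (2 * ?R k)" if z: "cmod z = 2 * ?R k" for z
  proof -
    have "(\<lambda>i. cmod (?f (k + i) z)) \<longlonglongrightarrow> cmod (f z)"
      using LIMSEQ_ignore_initial_segment[OF lim[of z], of k]
      by (intro tendsto_norm) (simp add: add.commute)
    moreover have "cmod (?f k z) / 2 \<le> cmod (?f (k + i) z)" for i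
    proof -
      have "1/2 * cmod (?f k z) \<le> (1/2 + (1/2) ^ i / 2) * cmod (?f k z)"
        by (intro mult_right_mono) auto
      also have "\<dots> \<le> cmod (?f (k + i) z)"
        by (rule norm_partial_fun_add_ge[OF base n k z])
      finally show ?thesis by simp
    qed
    ultimately have "cmod (?f k z) / 2 \<le> cmod (f z)"
      by (intro LIMSEQ_le_const) auto
    also have "\<dots> \<le> max_modulus f (2 * ?R k)"
      using cont z by (intro norm_le_max_modulus) (auto intro: continuous_on_subset)
    finally show ?thesis by simp
  qed
  then have "max_modulus (?f k) (2 * ?R k) \<le> 2 * max_modulus f (2 * ?R k)"
    using Rk by (intro max_modulus_le) auto
  moreover have "?R (Suc k) = max_modulus (?f k) (2 * ?R k)"
    using k by (cases k) auto
  moreover have "2 ^ (n k - 1) * 4 \<le> 2 ^ (n k - 1) * ?R k"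
    using Rk by (intro mult_left_mono) auto
  moreover have "2 ^ (n k - 1) * ?R k \<le> ?R (Suc k)"
    by (rule radius_Suc_ge_pow[OF base n2 k])
  moreover have "(2::real) ^ n k = 2 ^ (n k - 1) * 2"
    using n[OF k] by (simp flip: power_Suc2)
  ultimately show ?thesis by linarith
qed

section \<open>Exponents that are powers of the radii\<close>

text \<open>
  Radii and exponents bound each other in turn: large exponents before \<open>k\<close> make the \<open>k\<close>-th
  radius large, and that makes the \<open>k\<close>-th exponent large.
\<close>

lemma floor_power_exponents_ge:
  assumes base: "lam \<ge> 1" "N \<ge> 1" "admissible_base lam N R"
    and n: "\<And>k. k \<ge> 1 \<Longrightarrow> n k = nat \<lfloor>radius lam N R n k\<rfloor> ^ k" and "k \<ge> 1"
  shows "n k \<ge> 64"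
  using \<open>k \<ge> 1\<close>
proof (induction k rule: less_induct)
  case (less k)
  have "n j \<ge> 2" if "1 \<le> j" "j < k" for j
    using less.IH[of j] that by simp
  then have "radius lam N R n k \<ge> 64"
    using radius_ge[OF base less.prems, of n] by auto
  then have "64 \<le> nat \<lfloor>radius lam N R n k\<rfloor>" by linarith
  moreover have "\<dots> ^ 1 \<le> \<dots> ^ k"
    using less.prems calculation by (intro power_increasing) auto
  ultimately show ?case using n[OF less.prems] by simp
qed

lemma floor_power_exponents_admissible:
  assumes base: "lam \<ge> 1" "N \<ge> 1" "admissible_base lam N R"
    and n: "\<And>k. k \<ge> 1 \<Longrightarrow> n k = nat \<lfloor>radius lam N R n k\<rfloor> ^ k"
  shows "admissible_exponents n"
  unfolding admissible_exponents_def
proof (intro conjI allI impI)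
  have n64: "\<And>k. k \<ge> 1 \<Longrightarrow> n k \<ge> 64"
    by (rule floor_power_exponents_ge[OF base n])
  have n2: "n k \<ge> 2" if "k \<ge> 1" for k using n64[OF that] by simp
  show "n 1 \<ge> 8" using n64[of 1] by simp
  fix k :: nat assume k: "k \<ge> 1"
  have R: "radius lam N R n k \<ge> 64" "radius lam N R n k \<le> radius lam N R n (k + 1)"
    using radius_ge[OF base, of "k + 1" n] radius_ge[OF base k, of n] k n2 by auto
  have "n k = nat \<lfloor>radius lam N R n k\<rfloor> ^ k"
    by (rule n[OF k])
  also have "\<dots> < nat \<lfloor>radius lam N R n k\<rfloor> ^ (k + 1)"
    using R(1) by (intro power_strict_increasing) linarith+
  also have "\<dots> \<le> nat \<lfloor>radius lam N R n (k + 1)\<rfloor> ^ (k + 1)"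
    using R by (intro power_mono nat_mono floor_mono) auto
  also have "\<dots> = n (k + 1)"
    using n[of "k + 1"] by simp
  finally show "n k < n (k + 1)" .
qed

text \<open>
  For \<open>x \<ge> 64\<close> half of \<open>\<lfloor>x\<rfloor>\<close> exceeds \<open>sqrt (2 * x)\<close>; as \<open>k \<ge> 1\<close>, halving each of the \<open>k\<close>
  factors costs at least as much as halving the power.
\<close>

lemma sqrt_power_le_floor_power:
  fixes x :: real
  assumes "x \<ge> 64" "k \<ge> 1"
  shows "sqrt (2 * x) ^ k \<le> real (nat \<lfloor>x\<rfloor> ^ k) / 2"
proof -
  have fl: "real (nat \<lfloor>x\<rfloor>) \<ge> x - 1" using assms(1) by linarith
  have "sqrt (2 * x) \<le> (x - 1) / 2"
  proof (rule real_le_lsqrt)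
    have "64 * x \<le> x * x" using assms(1) by (intro mult_right_mono) auto
    moreover have "(x - 1) * (x - 1) = x * x - 2 * x + 1" by (simp add: algebra_simps)
    ultimately have "8 * x \<le> (x - 1) * (x - 1)" using assms(1) by linarith
    then show "2 * x \<le> ((x - 1) / 2)\<^sup>2" by (simp add: power2_eq_square)
  qed (use assms(1) in auto)
  also have "\<dots> \<le> real (nat \<lfloor>x\<rfloor>) / 2" using fl by simp
  finally have "sqrt (2 * x) ^ k \<le> (real (nat \<lfloor>x\<rfloor>) / 2) ^ k"
    using assms(1) by (intro power_mono) auto
  also have "\<dots> = real (nat \<lfloor>x\<rfloor>) ^ k / 2 ^ k" by (simp add: power_divide)
  also have "\<dots> \<le> real (nat \<lfloor>x\<rfloor>) ^ k / 2 ^ 1"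
    using assms(2) by (intro divide_left_mono power_increasing) auto
  finally show ?thesis by simp
qed

lemma floor_power_exponents_infinite_order:
  assumes base: "lam \<ge> 1" "N \<ge> 1" "admissible_base lam N R"
    and n: "\<And>k. k \<ge> 1 \<Longrightarrow> n k = nat \<lfloor>radius lam N R n k\<rfloor> ^ k"
  shows "\<exists>f. family_function lam N R n f \<and> transcendental_entire f \<and> growth_order f = \<infinity>"
proof -
  let ?R = "radius lam N R n" and ?f = "partial_fun lam N R n"
  have n64: "\<And>k. k \<ge> 1 \<Longrightarrow> n k \<ge> 64"
    by (rule floor_power_exponents_ge[OF base n])
  have n3: "n k \<ge> 3" and n2: "n k \<ge> 2" if "k \<ge> 1" for k using n64[OF that] by simp_all
  have R64: "?R k \<ge> 64" if "k \<ge> 1" for k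
    using radius_ge[OF base that, of n] n2 by auto
  define f where "f z = lim (\<lambda>k. ?f k z)" for z
  have unif: "uniform_limit K ?f f sequentially" if "compact K" for K
    unfolding f_def using uniformly_convergent_partial_fun[OF base n3 that]
    by (simp add: uniformly_convergent_uniform_limit_iff)
  have hol: "f holomorphic_on UNIV"
    using unif by (rule holomorphic_if_locally_uniform_limit[OF holomorphic_partial_fun])
  have lim: "(\<lambda>k. ?f k z) \<longlonglongrightarrow> f z" for z
    using tendsto_uniform_limitI[OF unif[of "{z}"]] by simp

  have "filterlim (\<lambda>i. 2 * (4 ^ i * 64 :: real)) at_top sequentially"
    by real_asymp
  moreover have "\<forall>\<^sub>F i in sequentially. 2 * (4 ^ i * 64) \<le> 2 * ?R (Suc i)"
  proof (intro always_eventually allI)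
    fix i
    have "4 ^ i * 64 \<le> 4 ^ i * ?R 1" using R64[of 1] by auto
    also have "\<dots> \<le> ?R (1 + i)" by (rule radius_add_ge[OF base n3]) auto
    finally show "2 * (4 ^ i * 64) \<le> 2 * ?R (Suc i)" by simp
  qed
  ultimately have "filterlim (\<lambda>i. 2 * ?R (Suc i)) at_top sequentially"
    by (rule filterlim_at_top_mono)
  then have unbounded: "filterlim (\<lambda>k. 2 * ?R k) at_top sequentially"
    by (rule filterlim_sequentially_Suc[THEN iffD1])

  have "exp (sqrt (2 * ?R k) ^ k) \<le> max_modulus f (2 * ?R k)" if k: "k \<ge> 1" for k
  proof -
    have "sqrt (2 * ?R k) ^ k \<le> real (n k) / 2"
      using sqrt_power_le_floor_power[OF R64[OF k] k] n[OF k] by simp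
    also have "\<dots> \<le> real (n k) * ln 2"
      using mult_left_mono[of "1/2" "ln 2" "real (n k)"] ln2_ge_two_thirds by simp
    finally have "exp (sqrt (2 * ?R k) ^ k) \<le> exp (real (n k) * ln 2)" by simp
    also have "\<dots> = 2 ^ n k" by (simp add: exp_of_nat_mult)
    also have "\<dots> \<le> max_modulus f (2 * ?R k)"
      using lim hol by (intro max_modulus_limit_ge[OF base n3 k] holomorphic_on_imp_continuous_on)
    finally show ?thesis .
  qed
  then have large: "\<forall>\<^sub>F k in sequentially. exp (sqrt (2 * ?R k) ^ k) \<le> max_modulus f (2 * ?R k)"
    by (auto simp: eventually_sequentially)

  have "family_function lam N R n f"
    unfolding family_function_def
    using unif floor_power_exponents_admissible[OF base n] by blast
  moreover have "transcendental_entire f"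
    unfolding transcendental_entire_def
    using hol not_poly_if_max_modulus_large[OF unbounded large] by blast
  moreover have "growth_order f = \<infinity>"
    by (rule growth_order_eq_infinity[OF unbounded large])
  ultimately show ?thesis by blast
qed

theorem theorem4p1:
  fixes lam R :: real and N :: nat
  assumes "lam \<ge> 1" and "N \<ge> 4" and "admissible_base lam N R"
  shows "(\<exists>n f. family_function lam N R n f \<and> transcendental_entire f \<and> growth_order f = \<infinity>) \<and>
    (\<forall>n. (\<forall>k\<ge>1. n k = nat \<lfloor>radius lam N R n k\<rfloor> ^ k) \<longrightarrow>
      (\<exists>f. family_function lam N R n f \<and> transcendental_entire f \<and> growth_order f = \<infinity>))"
proof -
  have "N \<ge> 1" using assms(2) by simp
  then have all: "\<exists>f. family_function lam N R n f \<and> transcendental_entire f \<and> growth_order f = \<infinity>"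
    if "\<forall>k\<ge>1. n k = nat \<lfloor>radius lam N R n k\<rfloor> ^ k" for n
    using that assms by (intro floor_power_exponents_infinite_order) auto
  moreover obtain n where "\<forall>k. n k = nat \<lfloor>radius lam N R n k\<rfloor> ^ k"
    using exists_floor_power_exponents by blast
  ultimately show ?thesis by blast
qed

end
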